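(* Let $\mathcal{E}=\mathbb{Z}[\mathbb{Q}/\mathbb{Z}\times\mathbb{Q}_+^*]$ be the free abelian group on the set $\mathbb{Q}/\mathbb{Z}\times\mathbb{Q}_+^*$, and for $x\in\mathbb{Z}[\mathbb{Q}/\mathbb{Z}]$, $r\in\mathbb{Q}_+^*$ let $\xi(x,r)\in\mathcal{E}$ be the corresponding element (so $\xi(\cdot,r)$ is additive and $\xi(e(s),r)$ is the basis element $(s,r)$). Then the following formulas, for all $x,y\in\mathbb{Z}[\mathbb{Q}/\mathbb{Z}]$, all $a,b\in\mathbb{N}$ and all $c,d\in\mathbb{N}$ with $(c,d)=1$, define a faithful representation of the ring $\mathcal{A}_{\mathbb{Z}}$ on $\mathcal{E}$: $$x\,\xi(y,c/d)=\xi(\sigma_c(x)y,\,c/d),$$ $$\tilde\mu_a\,\xi(y,c/d)=\xi(\tilde\rho_m(y),\,ac/d),\qquad m=(a,d),$$ $$\mu_b^*\,\xi(y,c/d)=(b,c)\,\xi(\sigma_{b/n}(y),\,c/(bd)),\qquad n=(b,c).$$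
   Context: $\mathbb{N}$ is the set of positive integers; $(m,n)$ denotes the gcd. $\mathbb{Z}[\mathbb{Q}/\mathbb{Z}]$ is the group ring with canonical basis $e(r)$, $r\in\mathbb{Q}/\mathbb{Z}$, and $e(a+b)=e(a)e(b)$. For $n\in\mathbb{N}$, $\sigma_n$ is the ring endomorphism of $\mathbb{Z}[\mathbb{Q}/\mathbb{Z}]$ with $\sigma_n(e(r))=e(nr)$, and $\tilde\rho_n$ is the additive map with $\tilde\rho_n(e(r))=\sum_{ns=r}e(s)$ (sum over the $s\in\mathbb{Q}/\mathbb{Z}$ with $ns=r$). $\mathcal{A}_{\mathbb{Z}}=\mathbb{Z}[\mathbb{Q}/\mathbb{Z}]\rtimes_{\tilde\rho}\mathbb{N}$ is the (unital, associative) ring generated by the group ring $\mathbb{Z}[\mathbb{Q}/\mathbb{Z}]$ and elements $\tilde\mu_n,\mu_n^*$ ($n\in\mathbb{N}$), subject to the relations (for all $x\in\mathbb{Z}[\mathbb{Q}/\mathbb{Z}]$ and all $n,m\in\mathbb{N}$): $\tilde\mu_n x\mu_n^*=\tilde\rho_n(x)$; $\mu_n^*x=\sigma_n(x)\mu_n^*$; $x\tilde\mu_n=\tilde\mu_n\sigma_n(x)$; $\tilde\mu_{nm}=\tilde\mu_n\tilde\mu_m$; $\mu_{nm}^*=\mu_n^*\mu_m^*$; $\mu_n^*\tilde\mu_n=n$; and $\tilde\mu_n\mu_m^*=\mu_m^*\tilde\mu_n$ whenever $(n,m)=1$. By convention $\tilde\mu_1=\mu_1^*=1$. *)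

theory Defs
  imports Complex_Main "HOL-Library.Poly_Mapping"
begin

section \<open>Positive integers and positive rationals\<close>

typedef pnat = "{n::nat. 0 < n}" morphisms nat_of pnat_of
  by auto

setup_lifting type_definition_pnat

instantiation pnat :: comm_monoid_mult
begin
lift_definition one_pnat :: pnat is 1 by simp
lift_definition times_pnat :: "pnat \<Rightarrow> pnat \<Rightarrow> pnat" is "(*)" by simp
instance by standard (transfer; simp add: ac_simps)+
end

lemma nat_of_pos [simp]: "0 < nat_of n"
  using nat_of by simp

lemma nat_of_one [simp]: "nat_of 1 = 1"
  by (fact one_pnat.rep_eq)

lemma nat_of_mult [simp]: "nat_of (m * n) = nat_of m * nat_of n"
  by (fact times_pnat.rep_eq)

typedef posrat = "{r::rat. 0 < r}" morphisms rat_of posrat_of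
  by (auto intro: exI[of _ 1])

setup_lifting type_definition_posrat

lift_definition ratio :: "pnat \<Rightarrow> pnat \<Rightarrow> posrat"
  is "\<lambda>c d. of_nat c / of_nat d"
  by simp


section \<open>The group ring of \<open>\<rat>/\<int>\<close>\<close>

quotient_type qmodz = rat / "\<lambda>r s. r - s \<in> \<int>"
proof (rule equivpI)
  show "reflp (\<lambda>r s::rat. r - s \<in> \<int>)"
    by (simp add: reflp_def)
  show "symp (\<lambda>r s::rat. r - s \<in> \<int>)"
    unfolding symp_def using Ints_minus by fastforce
  show "transp (\<lambda>r s::rat. r - s \<in> \<int>)"
    unfolding transp_def using Ints_add by fastforce
qed

instantiation qmodz :: ab_group_add
begin
lift_definition zero_qmodz :: qmodz is 0 .
lift_definition plus_qmodz :: "qmodz \<Rightarrow> qmodz \<Rightarrow> qmodz" is "(+)"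
  by (subst add_diff_add) (rule Ints_add)
lift_definition uminus_qmodz :: "qmodz \<Rightarrow> qmodz" is uminus
  by (subst minus_diff_minus) (rule Ints_minus)
lift_definition minus_qmodz :: "qmodz \<Rightarrow> qmodz \<Rightarrow> qmodz" is "(-)"
  subgoal for r r' s s'
    using Ints_diff[of "r - r'" "s - s'"] by (simp add: algebra_simps)
  done
instance
  by standard (transfer; simp add: algebra_simps)+
end

lift_definition nmul :: "nat \<Rightarrow> qmodz \<Rightarrow> qmodz" is "\<lambda>n r. of_nat n * r"
  by (subst right_diff_distrib [symmetric]) (rule Ints_mult [OF Ints_of_nat])

text \<open>
  With the convolution product of \<^theory>\<open>HOL-Library.Poly_Mapping\<close> this is the
  group ring (written additively in the exponents): \<open>frag_of r\<close> is the basis element \<open>e(r)\<close>.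
\<close>
type_synonym group_ring = "qmodz \<Rightarrow>\<^sub>0 int"

definition sigma :: "nat \<Rightarrow> group_ring \<Rightarrow> group_ring" where
  "sigma n = frag_extend (\<lambda>r. frag_of (nmul n r))"

text \<open>The index set of the inner sum is finite for \<open>n > 0\<close>, see \<open>finite_nmul_fibre\<close> below.\<close>
definition rho :: "nat \<Rightarrow> group_ring \<Rightarrow> group_ring" where
  "rho n = frag_extend (\<lambda>r. \<Sum>s | nmul n s = r. frag_of s)"

lemma sigma_frag_of [simp]: "sigma n (frag_of r) = frag_of (nmul n r)"
  by (simp add: sigma_def)

lemma rho_frag_of [simp]: "rho n (frag_of r) = (\<Sum>s | nmul n s = r. frag_of s)"
  by (simp add: rho_def)

lemma sigma_add: "sigma n (x + y) = sigma n x + sigma n y"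
  by (simp add: sigma_def frag_extend_add)

lemma sigma_diff: "sigma n (x - y) = sigma n x - sigma n y"
  by (simp add: sigma_def frag_extend_diff)

lemma rho_add: "rho n (x + y) = rho n x + rho n y"
  by (simp add: rho_def frag_extend_add)

lemma rho_diff: "rho n (x - y) = rho n x - rho n y"
  by (simp add: rho_def frag_extend_diff)

lemma nmul_zero [simp]: "nmul n 0 = 0"
  by transfer simp

lemma nmul_0 [simp]: "nmul 0 r = 0"
  by transfer simp

lemma nmul_add: "nmul n (r + s) = nmul n r + nmul n s"
  by transfer (simp add: algebra_simps)

lemma sigma_one [simp]: "sigma n 1 = 1"
  using sigma_frag_of[of n 0] by simp

lemma sigma_zero [simp]: "sigma n 0 = 0"
  by (simp add: sigma_def)

lemma frag_ring_induct [case_names zero basis diff]: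
  fixes P :: "('a \<Rightarrow>\<^sub>0 int) \<Rightarrow> bool"
  assumes "P 0" "\<And>r. P (frag_of r)" "\<And>x y. P x \<Longrightarrow> P y \<Longrightarrow> P (x - y)"
  shows "P x"
  using frag_induction[of x UNIV P] assms by auto

lemma sigma_mult: "sigma n (x * y) = sigma n x * sigma n y"
proof (induction x rule: frag_ring_induct)
  case (basis r)
  show ?case
    by (induction y rule: frag_ring_induct)
       (simp_all add: sigma_diff right_diff_distrib mult_single nmul_add)
qed (simp_all add: sigma_diff left_diff_distrib)

lemma nmul_fibre:
  assumes "0 < n"
  shows "finite {s. nmul n s = r}" and "card {s. nmul n s = r} = n"
proof -
  obtain q where r: "r = abs_qmodz q"
    using qmodz.abs_induct[of "\<lambda>r. \<exists>q. r = abs_qmodz q" r] by blast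
  define f where "f i = abs_qmodz ((q + of_nat i) / of_nat n)" for i
  have inj: "inj_on f {..<n}"
  proof (rule inj_onI)
    fix i j assume ij: "i \<in> {..<n}" "j \<in> {..<n}" "f i = f j"
    then have "(q + of_nat i) / of_nat n - (q + of_nat j) / of_nat n \<in> \<int>"
      by (simp add: f_def qmodz.abs_eq_iff)
    then obtain k where "(q + of_nat i) / of_nat n - (q + of_nat j) / of_nat n = of_int k"
      by (auto elim: Ints_cases)
    then have "of_nat n * ((q + of_nat i) / of_nat n - (q + of_nat j) / of_nat n)
        = of_nat n * (of_int k :: rat)"
      by simp
    then have "(of_int (int i - int j) :: rat) = of_int (k * int n)"
      using assms by (simp add: right_diff_distrib mult.commute)
    then have k: "int i - int j = k * int n"
      using of_int_eq_iff by blast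
    then have "int i mod int n = int j mod int n"
      by (metis mod_mult_self3 add.commute diff_add_cancel)
    then show "i = j"
      using ij by simp
  qed
  have "{s. nmul n s = r} = f ` {..<n}"
  proof (intro equalityI subsetI)
    fix s assume s: "s \<in> {s. nmul n s = r}"
    obtain t where t: "s = abs_qmodz t"
      using qmodz.abs_induct[of "\<lambda>s. \<exists>t. s = abs_qmodz t" s] by blast
    have "of_nat n * t - q \<in> \<int>"
      using s by (simp add: t r nmul.abs_eq qmodz.abs_eq_iff)
    then obtain k where k: "of_nat n * t - q = of_int k"
      by (auto elim: Ints_cases)
    define i where "i = nat (k mod int n)"
    have i: "int i = k mod int n" "i < n"
      using assms by (auto simp: i_def nat_less_iff)
    have "k = int n * (k div int n) + int i"
      using i by simp
    then have "(of_int k :: rat) = of_nat n * of_int (k div int n) + of_nat i"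
      by (metis of_int_add of_int_mult of_int_of_nat_eq)
    then have "t - (q + of_nat i) / of_nat n = of_int (k div int n)"
      using k assms by (simp add: field_simps)
    then have "s = f i"
      by (simp add: t f_def qmodz.abs_eq_iff)
    then show "s \<in> f ` {..<n}"
      using i by blast
  next
    fix s assume "s \<in> f ` {..<n}"
    then obtain i where "s = f i" by blast
    then show "s \<in> {s. nmul n s = r}"
      using assms by (simp add: f_def r nmul.abs_eq qmodz.abs_eq_iff)
  qed
  then show "finite {s. nmul n s = r}" "card {s. nmul n s = r} = n"
    using card_image[OF inj] by simp_all
qed

lemmas finite_nmul_fibre = nmul_fibre(1)


section \<open>The ring \<open>\<A>\<^sub>\<int>\<close> by generators and relations\<close>

text \<open>
  Formal ring expressions in the generators; the ring is their quotient by the least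
  congruence that contains the axioms of a unital associative ring, the requirement that
  \<open>Grp\<close> is a unital ring homomorphism on the group ring, and the defining relations. The
  integer \<open>n\<close> in \<open>\<mu>\<^sub>n\<^sup>* \<mu>\<^sub>n = n\<close> is written as the multiple \<open>n\<close> of the unit of the group ring.
\<close>

datatype bc_term =
    Zero | One | Neg bc_term | Add bc_term bc_term | Mul bc_term bc_term
  | Grp group_ring | Mu pnat | MuStar pnat

inductive bc_eq :: "bc_term \<Rightarrow> bc_term \<Rightarrow> bool" (infix "\<approx>" 50) where
  refl: "s \<approx> s"
| sym: "s \<approx> t \<Longrightarrow> t \<approx> s"
| trans: "s \<approx> t \<Longrightarrow> t \<approx> u \<Longrightarrow> s \<approx> u"
| cong_Neg: "s \<approx> t \<Longrightarrow> Neg s \<approx> Neg t"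
| cong_Add: "s \<approx> t \<Longrightarrow> s' \<approx> t' \<Longrightarrow> Add s s' \<approx> Add t t'"
| cong_Mul: "s \<approx> t \<Longrightarrow> s' \<approx> t' \<Longrightarrow> Mul s s' \<approx> Mul t t'"

| add_assoc: "Add (Add s t) u \<approx> Add s (Add t u)"
| add_comm: "Add s t \<approx> Add t s"
| add_zero: "Add Zero s \<approx> s"
| add_neg: "Add (Neg s) s \<approx> Zero"
| mul_assoc: "Mul (Mul s t) u \<approx> Mul s (Mul t u)"
| one_mul: "Mul One s \<approx> s"
| mul_one: "Mul s One \<approx> s"
| distrib_right: "Mul (Add s t) u \<approx> Add (Mul s u) (Mul t u)"
| distrib_left: "Mul s (Add t u) \<approx> Add (Mul s t) (Mul s u)"

| grp_one: "Grp 1 \<approx> One"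
| grp_add: "Grp (x + y) \<approx> Add (Grp x) (Grp y)"
| grp_mult: "Grp (x * y) \<approx> Mul (Grp x) (Grp y)"

| mu_grp_mustar: "Mul (Mul (Mu n) (Grp x)) (MuStar n) \<approx> Grp (rho (nat_of n) x)"
| mustar_grp: "Mul (MuStar n) (Grp x) \<approx> Mul (Grp (sigma (nat_of n) x)) (MuStar n)"
| grp_mu: "Mul (Grp x) (Mu n) \<approx> Mul (Mu n) (Grp (sigma (nat_of n) x))"
| mu_mult: "Mu (n * m) \<approx> Mul (Mu n) (Mu m)"
| mustar_mult: "MuStar (n * m) \<approx> Mul (MuStar n) (MuStar m)"
| mustar_mu: "Mul (MuStar n) (Mu n) \<approx> Grp (of_nat (nat_of n))"
| mu_mustar: "coprime (nat_of n) (nat_of m) \<Longrightarrow>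
    Mul (Mu n) (MuStar m) \<approx> Mul (MuStar m) (Mu n)"
| mu_one: "Mu 1 \<approx> One"
| mustar_one: "MuStar 1 \<approx> One"

quotient_type bc_ring = bc_term / bc_eq
  by (rule equivpI) (auto simp: reflp_def symp_def transp_def intro: bc_eq.intros)

lift_definition grp :: "group_ring \<Rightarrow> bc_ring" is Grp .
lift_definition mu :: "pnat \<Rightarrow> bc_ring" is Mu .
lift_definition mustar :: "pnat \<Rightarrow> bc_ring" is MuStar .

text \<open>
  The following evaluation into the commutative group ring only serves to show that
  \<open>0 \<noteq> 1\<close> in the presented ring, as required by the class \<^class>\<open>ring_1\<close>.
\<close>

primrec bc_eval :: "bc_term \<Rightarrow> group_ring" where
  "bc_eval Zero = 0"
| "bc_eval One = 1"
| "bc_eval (Neg s) = - bc_eval s"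
| "bc_eval (Add s t) = bc_eval s + bc_eval t"
| "bc_eval (Mul s t) = bc_eval s * bc_eval t"
| "bc_eval (Grp x) = sigma 0 x"
| "bc_eval (Mu n) = of_nat (nat_of n)"
| "bc_eval (MuStar n) = 1"

lemma sigma_0_sigma: "sigma 0 (sigma n x) = sigma 0 x"
  by (induction x rule: frag_ring_induct) (simp_all add: sigma_diff)

lemma sigma_sum: "sigma n (sum f A) = (\<Sum>i\<in>A. sigma n (f i))"
  by (induction A rule: infinite_finite_induct) (simp_all add: sigma_add)

lemma sigma_0_rho: "0 < n \<Longrightarrow> sigma 0 (rho n x) = of_nat n * sigma 0 x"
proof (induction x rule: frag_ring_induct)
  case zero
  show ?case by (simp add: rho_def)
next
  case (basis r)
  then show ?case by (simp add: sigma_sum nmul_fibre)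
next
  case (diff x y)
  then show ?case by (simp add: sigma_diff rho_diff right_diff_distrib)
qed

lemma sigma_of_nat: "sigma n (of_nat k) = of_nat k"
  by (induction k) (simp_all add: sigma_add)

lemma bc_eval_cong: "s \<approx> t \<Longrightarrow> bc_eval s = bc_eval t"
  by (induction rule: bc_eq.induct)
     (simp_all add: algebra_simps sigma_add sigma_mult sigma_0_sigma sigma_0_rho sigma_of_nat)

instantiation bc_ring :: ring_1
begin
lift_definition zero_bc_ring :: bc_ring is Zero .
lift_definition one_bc_ring :: bc_ring is One .
lift_definition uminus_bc_ring :: "bc_ring \<Rightarrow> bc_ring" is Neg by (rule cong_Neg)
lift_definition plus_bc_ring :: "bc_ring \<Rightarrow> bc_ring \<Rightarrow> bc_ring" is Add by (rule cong_Add)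
lift_definition times_bc_ring :: "bc_ring \<Rightarrow> bc_ring \<Rightarrow> bc_ring" is Mul by (rule cong_Mul)
definition minus_bc_ring :: "bc_ring \<Rightarrow> bc_ring \<Rightarrow> bc_ring" where
  "minus_bc_ring a b = a + - b"
instance
proof
  show "(0::bc_ring) \<noteq> 1"
    by transfer (auto dest: bc_eval_cong)
qed (unfold minus_bc_ring_def, (rule HOL.refl | (transfer, rule add_assoc add_comm add_zero
  add_neg mul_assoc one_mul mul_one distrib_right distrib_left))+)
end


section \<open>Representations and the module \<open>\<E>\<close>\<close>

definition ring_representation :: "('r::ring_1 \<Rightarrow> 'm::ab_group_add \<Rightarrow> 'm) \<Rightarrow> bool" where
  "ring_representation \<pi> \<longleftrightarrow>
     (\<forall>a. additive (\<pi> a)) \<and>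
     (\<forall>a b v. \<pi> (a + b) v = \<pi> a v + \<pi> b v) \<and>
     (\<forall>a b v. \<pi> (a * b) v = \<pi> a (\<pi> b v)) \<and>
     (\<forall>v. \<pi> 1 v = v)"

definition faithful_representation :: "('r::ring_1 \<Rightarrow> 'm::ab_group_add \<Rightarrow> 'm) \<Rightarrow> bool" where
  "faithful_representation \<pi> \<longleftrightarrow> ring_representation \<pi> \<and> inj \<pi>"

type_synonym bc_module = "(qmodz \<times> posrat) \<Rightarrow>\<^sub>0 int"

definition xi :: "group_ring \<Rightarrow> posrat \<Rightarrow> bc_module" where
  "xi x r = frag_extend (\<lambda>s. frag_of (s, r)) x"

end

theory Submission
  imports Defs
begin

text \<open>
  The operators are additive, so it suffices to check the relations on \<open>\<xi>(y, c/d)\<close> with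
  \<open>(c, d) = 1\<close>. Each gcd in the formulas is eliminated by writing the two numbers as
  \<open>m a'\<close> and \<open>m d'\<close> with \<open>(a', d') = 1\<close>, which leaves identities between the \<open>\<sigma>\<close> and \<open>\<rho>\<close>.
  For faithfulness, the additive map \<open>\<Phi>\<close> from \<open>\<E>\<close> to the ring with
  \<open>\<Phi>(\<xi>(x, c/d)) = \<mu>\<^sub>c x \<mu>\<^sub>d\<^sup>*\<close> (called \<open>to_ring\<close> below) is linear over the ring and sends
  \<open>\<xi>(1, 1)\<close> to \<open>1\<close>, so that \<open>a = \<Phi>(a \<xi>(1, 1))\<close> can be recovered from the action of \<open>a\<close>.
\<close>

section \<open>The maps \<open>\<sigma>\<^sub>n\<close> and \<open>\<rho>\<^sub>n\<close>\<close>

lemma nmul_nmul: "nmul m (nmul n r) = nmul (m * n) r"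
  by transfer (simp add: algebra_simps)

lemma nmul_1 [simp]: "nmul (Suc 0) r = r"
  by transfer simp

lemma nmul_diff: "nmul n (r - s) = nmul n r - nmul n s"
  by transfer (simp add: algebra_simps)

lemma nmul_mult_add: "nmul (k * n + j) r = nmul k (nmul n r) + nmul j r"
  by transfer (simp add: algebra_simps)

text \<open>By Bezout \<open>m * x = n * y + 1\<close>, so \<open>r\<close> is \<open>x\<close>
  times \<open>nmul m r\<close> minus \<open>y\<close> times \<open>nmul n r\<close> and is
  determined by these two multiples. If \<open>m = 0\<close>, coprimality forces
  \<open>n = 1\<close>.\<close>

lemma nmul_coprime_inj:
  assumes "coprime m n" "nmul m s = nmul m t" "nmul n s = nmul n t"
  shows "s = t"
proof (cases "m = 0")
  case True
  then show ?thesis using assms by simp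
next
  case False
  obtain x y where "m * x = n * y + 1"
    using bezout_nat[OF False, of n] assms(1) by auto
  then have "nmul (x * m) r = nmul y (nmul n r) + r" for r
    using nmul_mult_add[of y n 1 r] by (simp add: mult.commute)
  then have "nmul x (nmul m r) = nmul y (nmul n r) + r" for r
    by (simp add: nmul_nmul)
  then show ?thesis
    using assms by (metis add_left_imp_eq)
qed

lemma sigma_sigma: "sigma m (sigma n x) = sigma (m * n) x"
  by (induction x rule: frag_ring_induct) (simp_all add: sigma_diff nmul_nmul)

lemma sigma_Suc_0 [simp]: "sigma (Suc 0) x = x"
  by (induction x rule: frag_ring_induct) (simp_all add: sigma_diff)

lemma rho_zero [simp]: "rho n 0 = 0"
  by (simp add: rho_def)

lemma rho_sum: "rho n (sum f A) = (\<Sum>i\<in>A. rho n (f i))"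
  by (induction A rule: infinite_finite_induct) (simp_all add: rho_add)

lemma rho_Suc_0 [simp]: "rho (Suc 0) x = x"
  by (induction x rule: frag_ring_induct) (simp_all add: rho_diff)

text \<open>The fibre of multiplication by \<open>m * n\<close> over \<open>r\<close> is the
  disjoint union, over the \<open>t\<close> with \<open>nmul n t = r\<close>, of the fibres of
  multiplication by \<open>m\<close> over \<open>t\<close>.\<close>

lemma rho_rho:
  assumes "0 < m" "0 < n"
  shows "rho m (rho n x) = rho (m * n) x"
proof (induction x rule: frag_ring_induct)
  case (basis r)
  have "rho m (rho n (frag_of r)) =
      (\<Sum>t | nmul n t = r. \<Sum>s | s \<in> {s. nmul (m * n) s = r} \<and> nmul m s = t. frag_of s)"
    by (auto simp: rho_sum nmul_nmul mult.commute intro!: sum.cong)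
  also have "\<dots> = (\<Sum>s | nmul (m * n) s = r. frag_of s)"
    by (rule sum.group) (use assms in \<open>auto simp: finite_nmul_fibre nmul_nmul mult.commute\<close>)
  finally show ?case by simp
qed (simp_all add: rho_diff)

text \<open>Each of the \<open>n\<close> elements of a fibre is sent back to its base point.\<close>

lemma sigma_rho_cancel: "0 < n \<Longrightarrow> sigma n (rho n x) = of_nat n * x"
  by (induction x rule: frag_ring_induct)
     (simp_all add: sigma_sum nmul_fibre sigma_diff rho_diff right_diff_distrib)

text \<open>Multiplication by \<open>m\<close> maps the \<open>n\<close>-fibre over \<open>r\<close>
  into the \<open>n\<close>-fibre over \<open>nmul m r\<close>. It is injective there by
  coprimality, and both fibres have \<open>n\<close> elements, so it is a bijection.\<close>

lemma sigma_rho_coprime: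
  assumes "coprime m n" "0 < n"
  shows "sigma m (rho n x) = rho n (sigma m x)"
proof (induction x rule: frag_ring_induct)
  case (basis r)
  have inj: "inj_on (nmul m) {s. nmul n s = r}"
    using nmul_coprime_inj[OF assms(1)] by (auto intro!: inj_onI)
  have "nmul m ` {s. nmul n s = r} = {s. nmul n s = nmul m r}"
  proof (rule card_subset_eq)
    show "nmul m ` {s. nmul n s = r} \<subseteq> {s. nmul n s = nmul m r}"
      by (auto simp: nmul_nmul mult.commute)
  qed (use assms in \<open>simp_all add: nmul_fibre card_image[OF inj]\<close>)
  then have "(\<Sum>s | nmul n s = nmul m r. frag_of s) = (\<Sum>s | nmul n s = r. frag_of (nmul m s))"
    using sum.reindex[OF inj, of frag_of] by simp
  then show ?case by (simp add: sigma_sum)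
qed (simp_all add: sigma_diff rho_diff)

lemma frag_of_mult: "frag_of r * frag_of s = frag_of (r + s)"
  by (simp add: mult_single)

text \<open>The projection formula: translation by \<open>r\<close> is a bijection from the
  \<open>n\<close>-fibre over \<open>t\<close> to the one over \<open>nmul n r + t\<close>.\<close>

lemma rho_sigma_mult:
  assumes "0 < n"
  shows "rho n (sigma n x * y) = x * rho n y"
proof (induction x rule: frag_ring_induct)
  case (basis r)
  show ?case
  proof (induction y rule: frag_ring_induct)
    case (basis t)
    have "(\<Sum>s | nmul n s = nmul n r + t. frag_of s) = (\<Sum>s | nmul n s = t. frag_of (r + s))"
      by (rule sum.reindex_bij_witness[where i = "\<lambda>s. r + s" and j = "\<lambda>s. s - r"])
         (auto simp: nmul_add nmul_diff)
    then show ?case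
      by (simp add: frag_of_mult sum_distrib_left)
  qed (simp_all add: rho_diff right_diff_distrib)
qed (simp_all add: sigma_diff rho_diff left_diff_distrib)


section \<open>Reduced fractions and the module\<close>

lemma nat_of_inject' [simp]: "nat_of a = nat_of b \<longleftrightarrow> a = b"
  by (rule nat_of_inject)

lemma ratio_eq_iff: "ratio a b = ratio c d \<longleftrightarrow> a * d = c * b"
proof -
  have "ratio a b = ratio c d \<longleftrightarrow>
      (of_nat (nat_of a * nat_of d) :: rat) = of_nat (nat_of c * nat_of b)"
    by (simp add: rat_of_inject[symmetric] ratio.rep_eq field_simps)
  also have "\<dots> \<longleftrightarrow> a * d = c * b"
    by (simp only: of_nat_eq_iff nat_of_mult[symmetric] nat_of_inject')
  finally show ?thesis .
qed

lemma ratio_cancel: "ratio (k * a) (k * b) = ratio a b"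
  by (simp add: ratio_eq_iff ac_simps)

lemma pnat_gcd_decomp:
  obtains m a' d' where "a = m * a'" "d = m * d'" "coprime (nat_of a') (nat_of d')"
proof -
  define g where "g = gcd (nat_of a) (nat_of d)"
  have g: "0 < g" by (simp add: g_def)
  obtain a' d' where ad: "nat_of a = g * a'" "nat_of d = g * d'" "coprime a' d'"
    using gcd_coprime_exists[of "nat_of a" "nat_of d"] g unfolding g_def
    by (metis mult.commute not_gr0)
  have pos: "0 < a'" "0 < d'"
    using ad nat_of_pos[of a] nat_of_pos[of d] by (auto intro!: Nat.gr0I)
  have inv: "nat_of (pnat_of k) = k" if "0 < k" for k
    using that by (simp add: pnat_of_inverse)
  have "a = pnat_of g * pnat_of a'" "d = pnat_of g * pnat_of d'"
    using ad g pos by (simp_all flip: nat_of_inject add: inv)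
  then show ?thesis
    using that ad pos by (simp add: inv)
qed

lemma posrat_reduced:
  obtains c d where "r = ratio c d" "coprime (nat_of c) (nat_of d)"
proof -
  obtain p q where pq: "rat_of r = of_int p / of_int q" "0 < q" "coprime p q"
    by (metis quotient_of_div quotient_of_denom_pos quotient_of_coprime prod.exhaust)
  have "0 < rat_of r" using rat_of by simp
  then have p: "0 < p"
    using pq by (simp add: zero_less_divide_iff)
  define c d where "c = pnat_of (nat p)" and "d = pnat_of (nat q)"
  have cd: "nat_of c = nat p" "nat_of d = nat q"
    using p pq by (simp_all add: c_def d_def pnat_of_inverse)
  have "r = ratio c d"
    using p pq by (simp flip: rat_of_inject add: ratio.rep_eq cd)
  moreover have "coprime (nat_of c) (nat_of d)"
    using p pq by (simp add: cd coprime_nat_abs_left_iff flip: coprime_int_iff)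
  ultimately show ?thesis using that by blast
qed

lemma ratio_reduced_unique:
  assumes "ratio a b = ratio c d" "coprime (nat_of a) (nat_of b)" "coprime (nat_of c) (nat_of d)"
  shows "a = c \<and> b = d"
proof -
  have "nat_of a * nat_of d = nat_of c * nat_of b"
    using assms(1) unfolding ratio_eq_iff by (metis nat_of_mult)
  then have "nat_of a = nat_of c \<and> nat_of d = nat_of b"
    using assms(2,3) coprime_crossproduct_nat[of "nat_of a" "nat_of b" "nat_of c" "nat_of d"]
    by (simp add: mult.commute)
  then show ?thesis by simp
qed

text \<open>The choice is harmless: a reduced form exists by \<open>posrat_reduced\<close> and is
  unique by \<open>ratio_reduced_unique\<close>.\<close>

definition num_den :: "posrat \<Rightarrow> pnat \<times> pnat" where
  "num_den r = (SOME (c, d). r = ratio c d \<and> coprime (nat_of c) (nat_of d))"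

lemma num_den_ratio [simp]:
  assumes "coprime (nat_of c) (nat_of d)"
  shows "num_den (ratio c d) = (c, d)"
  unfolding num_den_def
  by (rule some_equality) (use assms in \<open>auto dest: ratio_reduced_unique\<close>)

section \<open>The elements \<open>xi y r\<close> and additive maps on the module\<close>

lemma xi_zero [simp]: "xi 0 r = 0"
  and xi_frag_of [simp]: "xi (frag_of s) r = frag_of (s, r)"
  and xi_add: "xi (x + y) r = xi x r + xi y r"
  and xi_diff: "xi (x - y) r = xi x r - xi y r"
  by (simp_all add: xi_def frag_extend_add frag_extend_diff)

lemma xi_of_nat_mult: "xi (of_nat n * x) r = frag_cmul (int n) (xi x r)"
  by (induction n) (simp_all add: xi_add ring_distribs frag_cmul_distrib)

text \<open>Every basis element is \<open>xi (frag_of s) (ratio c d)\<close> for a reduced fraction.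
  Relations, uniqueness and linearity of \<open>to_ring\<close> are all reduced to such elements in
  this way.\<close>

lemma module_hom_eqI:
  fixes f g :: "bc_module \<Rightarrow> 'b::ab_group_add"
  assumes "additive f" "additive g"
    and "\<And>y c d. coprime (nat_of c) (nat_of d) \<Longrightarrow> f (xi y (ratio c d)) = g (xi y (ratio c d))"
  shows "f = g"
proof
  fix v show "f v = g v"
  proof (induction v rule: frag_ring_induct)
    case (basis p)
    obtain s r where p: "p = (s, r)" by fastforce
    obtain c d where "r = ratio c d" "coprime (nat_of c) (nat_of d)"
      by (rule posrat_reduced)
    then show ?case
      using assms(3)[of c d "frag_of s"] by (simp add: p)
  qed (use assms(1,2) in \<open>simp_all add: additive.zero additive.diff\<close>)
qed

lemma additive_frag_extend: "additive (frag_extend f)"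
  by (simp add: additive_def frag_extend_add)

text \<open>Passes from a formula on the basis elements \<open>(s, r)\<close>, which is how the
  operators are defined, to the formula for all \<open>y\<close>.\<close>

lemma frag_extend_xi:
  assumes "\<And>s. f (s, r) = g (frag_of s)" "additive g"
  shows "frag_extend f (xi y r) = g y"
  by (induction y rule: frag_ring_induct)
     (use assms in \<open>simp_all add: xi_diff frag_extend_diff additive.zero additive.diff\<close>)


section \<open>The operators\<close>

definition grp_op :: "group_ring \<Rightarrow> bc_module \<Rightarrow> bc_module" where
  "grp_op x = frag_extend (\<lambda>(s, r). case num_den r of (c, d) \<Rightarrow>
     xi (sigma (nat_of c) x * frag_of s) r)"

definition mu_op :: "pnat \<Rightarrow> bc_module \<Rightarrow> bc_module" where
  "mu_op a = frag_extend (\<lambda>(s, r). case num_den r of (c, d) \<Rightarrow>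
     xi (rho (gcd (nat_of a) (nat_of d)) (frag_of s)) (ratio (a * c) d))"

definition mustar_op :: "pnat \<Rightarrow> bc_module \<Rightarrow> bc_module" where
  "mustar_op b = frag_extend (\<lambda>(s, r). case num_den r of (c, d) \<Rightarrow>
     frag_cmul (int (gcd (nat_of b) (nat_of c)))
       (xi (sigma (nat_of b div gcd (nat_of b) (nat_of c)) (frag_of s)) (ratio c (b * d))))"

lemma additive_ops: "additive (grp_op x)" "additive (mu_op a)" "additive (mustar_op b)"
  by (simp_all add: grp_op_def mu_op_def mustar_op_def additive_frag_extend)

lemma grp_op_xi:
  assumes "coprime (nat_of c) (nat_of d)"
  shows "grp_op x (xi y (ratio c d)) = xi (sigma (nat_of c) x * y) (ratio c d)"
  unfolding grp_op_def
  by (rule frag_extend_xi) (use assms in \<open>auto simp: additive_def ring_distribs xi_add\<close>)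

lemma mu_op_xi_gcd:
  assumes "coprime (nat_of c) (nat_of d)"
  shows "mu_op a (xi y (ratio c d)) = xi (rho (gcd (nat_of a) (nat_of d)) y) (ratio (a * c) d)"
  unfolding mu_op_def
  by (rule frag_extend_xi) (use assms in \<open>auto simp: additive_def rho_add xi_add\<close>)

lemma mustar_op_xi_gcd:
  assumes "coprime (nat_of c) (nat_of d)"
  shows "mustar_op b (xi y (ratio c d)) = frag_cmul (int (gcd (nat_of b) (nat_of c)))
     (xi (sigma (nat_of b div gcd (nat_of b) (nat_of c)) y) (ratio c (b * d)))"
  unfolding mustar_op_def
  by (rule frag_extend_xi)
     (use assms in \<open>auto simp: additive_def sigma_add xi_add frag_cmul_distrib2\<close>)

text \<open>The form without gcd. The common factor \<open>m\<close> cancels from the resulting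
  fraction, and the hypotheses make \<open>a * c\<close> over \<open>d\<close> reduced again, so
  that operators can be composed.\<close>

lemma mu_op_xi:
  assumes "coprime (nat_of c) (nat_of (m * d))" "coprime (nat_of a) (nat_of d)"
  shows "mu_op (m * a) (xi y (ratio c (m * d))) = xi (rho (nat_of m) y) (ratio (a * c) d)"
proof -
  have "gcd (nat_of (m * a)) (nat_of (m * d)) = nat_of m"
    using assms(2) by (simp add: gcd_mult_distrib_nat[symmetric])
  then show ?thesis
    using mu_op_xi_gcd[OF assms(1), of "m * a" y]
    by (simp add: ratio_cancel mult.assoc del: nat_of_mult)
qed

text \<open>The counterpart for \<open>mustar_op\<close>: here \<open>k\<close> is cancelled, and
  \<open>c\<close> over \<open>b * d\<close> is again reduced.\<close>

lemma mustar_op_xi: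
  assumes "coprime (nat_of (k * c)) (nat_of d)" "coprime (nat_of b) (nat_of c)"
  shows "mustar_op (k * b) (xi y (ratio (k * c) d)) =
    frag_cmul (int (nat_of k)) (xi (sigma (nat_of b) y) (ratio c (b * d)))"
proof -
  have "gcd (nat_of (k * b)) (nat_of (k * c)) = nat_of k"
    using assms(2) by (simp add: gcd_mult_distrib_nat[symmetric])
  moreover have "nat_of (k * b) div nat_of k = nat_of b"
    using nat_of_pos[of k] by simp
  ultimately show ?thesis
    using mustar_op_xi_gcd[OF assms(1), of "k * b" y]
    by (simp add: ratio_cancel mult.assoc del: nat_of_mult)
qed

lemma ops_frag_cmul:
  "grp_op x (frag_cmul k v) = frag_cmul k (grp_op x v)"
  "mu_op a (frag_cmul k v) = frag_cmul k (mu_op a v)"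
  "mustar_op b (frag_cmul k v) = frag_cmul k (mustar_op b v)"
  by (simp_all add: grp_op_def mu_op_def mustar_op_def frag_extend_cmul)


section \<open>The representation\<close>

primrec term_op :: "bc_term \<Rightarrow> bc_module \<Rightarrow> bc_module" where
  "term_op Zero = (\<lambda>v. 0)"
| "term_op One = (\<lambda>v. v)"
| "term_op (Neg s) = (\<lambda>v. - term_op s v)"
| "term_op (Add s t) = (\<lambda>v. term_op s v + term_op t v)"
| "term_op (Mul s t) = (\<lambda>v. term_op s (term_op t v))"
| "term_op (Grp x) = grp_op x"
| "term_op (Mu a) = mu_op a"
| "term_op (MuStar b) = mustar_op b"

lemma additive_term_op: "additive (term_op t)"
  by (induction t) (simp_all add: additive_ops, auto simp: additive_def)

lemma term_op_eqI:
  assumes "\<And>y c d. coprime (nat_of c) (nat_of d) \<Longrightarrow>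
    term_op s (xi y (ratio c d)) = term_op t (xi y (ratio c d))"
  shows "term_op s = term_op t"
  by (rule module_hom_eqI[OF additive_term_op additive_term_op assms])

text \<open>The congruence rules and ring axioms hold for composition and pointwise addition of
  operators; only left distributivity needs additivity. The relations between the generators are
  checked on reduced fractions.\<close>

lemma term_op_cong: "s \<approx> t \<Longrightarrow> term_op s = term_op t"
proof (induction rule: bc_eq.induct)
  case (distrib_left s t u)
  then show ?case
    using additive.add[OF additive_term_op] by auto
next
  case grp_one
  show ?case
    by (rule term_op_eqI) (simp add: grp_op_xi)
next
  case (grp_add x y)
  show ?case
    by (rule term_op_eqI) (simp add: grp_op_xi sigma_add ring_distribs xi_add)
next
  case (grp_mult x y)
  show ?case
    by (rule term_op_eqI) (simp add: grp_op_xi sigma_mult ac_simps)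
next
  case (mu_grp_mustar n x)
  show ?case
  proof (rule term_op_eqI)
    fix y c d assume cd: "coprime (nat_of c) (nat_of d)"
    obtain k n' c' where dec: "n = k * n'" "c = k * c'" "coprime (nat_of n') (nat_of c')"
      by (rule pnat_gcd_decomp)
    \<comment> \<open>\<open>mustar_op n\<close> leads to the reduced fraction \<open>c'\<close>
      over \<open>n' * d\<close>, whose denominator has gcd \<open>n'\<close> with
      \<open>n = k * n'\<close>. Hence \<open>mu_op n\<close> applies \<open>rho ?N\<close> and
      leads back to \<open>c\<close> over \<open>d\<close>.\<close>
    have cop: "coprime (nat_of c') (nat_of (n' * d))" "coprime (nat_of k) (nat_of d)"
      using cd dec by (auto simp: coprime_commute)
    let ?N = "nat_of n'" and ?C = "nat_of c'" and ?K = "nat_of k"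
    have "mu_op n (grp_op x (mustar_op n (xi y (ratio c d)))) =
        frag_cmul (int ?K) (xi (rho ?N (sigma ?C x * sigma ?N y)) (ratio c d))"
      using cd dec cop mu_op_xi[of c' n' d k]
      by (simp add: mustar_op_xi grp_op_xi ops_frag_cmul mult.commute[of n'])
    also have "rho ?N (sigma ?C x * sigma ?N y) = rho ?N (sigma ?C x) * y"
      using rho_sigma_mult[of ?N y "sigma ?C x"] by (simp add: mult.commute)
    also have "frag_cmul (int ?K) (xi (rho ?N (sigma ?C x) * y) (ratio c d)) =
        xi (of_nat ?K * sigma ?C (rho ?N x) * y) (ratio c d)"
      using dec(3) by (simp add: mult.assoc xi_of_nat_mult sigma_rho_coprime coprime_commute)
    \<comment> \<open>The integer factor is absorbed as \<open>sigma ?K\<close> after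
      \<open>rho ?K\<close>, which completes \<open>sigma ?C\<close> to the index \<open>c\<close>
      and \<open>rho ?N\<close> to the index \<open>n\<close>.\<close>
    also have "of_nat ?K * sigma ?C (rho ?N x) = sigma (nat_of c) (rho (nat_of n) x)"
    proof -
      have "sigma (nat_of c) (rho (nat_of n) x) = sigma ?C (sigma ?K (rho ?K (rho ?N x)))"
        by (simp add: dec sigma_sigma rho_rho mult.commute)
      then show ?thesis
        by (simp add: sigma_mult sigma_of_nat sigma_rho_cancel)
    qed
    finally show "term_op (Mul (Mul (Mu n) (Grp x)) (MuStar n)) (xi y (ratio c d)) =
        term_op (Grp (rho (nat_of n) x)) (xi y (ratio c d))"
      using cd by (simp add: grp_op_xi)
  qed
next
  case (mustar_grp n x)
  show ?case
  proof (rule term_op_eqI)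
    fix y c d assume cd: "coprime (nat_of c) (nat_of d)"
    obtain k n' c' where dec: "n = k * n'" "c = k * c'" "coprime (nat_of n') (nat_of c')"
      by (rule pnat_gcd_decomp)
    have cop: "coprime (nat_of c') (nat_of (n' * d))"
      using cd dec by (auto simp: coprime_commute)
    show "term_op (Mul (MuStar n) (Grp x)) (xi y (ratio c d)) =
        term_op (Mul (Grp (sigma (nat_of n) x)) (MuStar n)) (xi y (ratio c d))"
    proof -
      have "mustar_op n (grp_op x (xi y (ratio c d))) = frag_cmul (int (nat_of k))
          (xi (sigma (nat_of n' * nat_of c) x * sigma (nat_of n') y) (ratio c' (n' * d)))"
        using cd dec mustar_op_xi[of k c' d n'] by (simp add: grp_op_xi sigma_mult sigma_sigma)
      moreover have "grp_op (sigma (nat_of n) x) (mustar_op n (xi y (ratio c d))) =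
          frag_cmul (int (nat_of k))
            (xi (sigma (nat_of c' * nat_of n) x * sigma (nat_of n') y) (ratio c' (n' * d)))"
        using cd dec mustar_op_xi[of k c' d n'] grp_op_xi[OF cop]
        by (simp add: ops_frag_cmul sigma_sigma)
      moreover have "nat_of n' * nat_of c = nat_of c' * nat_of n"
        by (simp add: dec)
      ultimately show ?thesis by simp
    qed
  qed
next
  case (grp_mu x n)
  show ?case
  proof (rule term_op_eqI)
    fix y c d assume cd: "coprime (nat_of c) (nat_of d)"
    obtain m n' d' where dec: "n = m * n'" "d = m * d'" "coprime (nat_of n') (nat_of d')"
      by (rule pnat_gcd_decomp)
    have cop: "coprime (nat_of (n' * c)) (nat_of d')"
      using cd dec by auto
    \<comment> \<open>Since \<open>c * n = m * (n' * c)\<close>, the left factor is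
      \<open>sigma (nat_of m)\<close> of something, and the projection formula applies.\<close>
    have "rho (nat_of m) (sigma (nat_of (c * n)) x * y) = sigma (nat_of (n' * c)) x * rho (nat_of m) y"
      using rho_sigma_mult[of "nat_of m" "sigma (nat_of (n' * c)) x" y]
      by (simp add: sigma_sigma dec ac_simps)
    then show "term_op (Mul (Grp x) (Mu n)) (xi y (ratio c d)) =
        term_op (Mul (Mu n) (Grp (sigma (nat_of n) x))) (xi y (ratio c d))"
      using cd cop dec by (simp add: grp_op_xi mu_op_xi sigma_sigma)
  qed
next
  case (mu_mult n m)
  show ?case
  proof (rule term_op_eqI)
    fix y c d assume cd: "coprime (nat_of c) (nat_of d)"
    obtain g m' d1 where dec: "m = g * m'" "d = g * d1" "coprime (nat_of m') (nat_of d1)"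
      by (rule pnat_gcd_decomp)
    \<comment> \<open>After \<open>mu_op m\<close> the reduced denominator is \<open>d1\<close>, so
      the second gcd is taken with \<open>d1\<close>. As \<open>m'\<close> and \<open>n'\<close> are
      prime to \<open>d'\<close>, the gcd of \<open>n * m\<close> and \<open>d\<close> is
      \<open>h * g\<close>.\<close>
    obtain h n' d' where dec': "n = h * n'" "d1 = h * d'" "coprime (nat_of n') (nat_of d')"
      by (rule pnat_gcd_decomp)
    have "mu_op n (mu_op m (xi y (ratio c d))) =
        xi (rho (nat_of h) (rho (nat_of g) y)) (ratio (n' * (m' * c)) d')"
      using cd dec dec' mu_op_xi[of c g d1 m'] mu_op_xi[of "m' * c" h d' n'] by simp
    moreover have "mu_op (n * m) (xi y (ratio c d)) =
        xi (rho (nat_of (h * g)) y) (ratio (n' * m' * c) d')"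
      using cd dec dec' mu_op_xi[of c "h * g" d' "n' * m'" y] by (simp add: ac_simps)
    ultimately show "term_op (Mu (n * m)) (xi y (ratio c d)) =
        term_op (Mul (Mu n) (Mu m)) (xi y (ratio c d))"
      by (simp add: rho_rho mult.assoc)
  qed
next
  case (mustar_mult n m)
  show ?case
  proof (rule term_op_eqI)
    fix y c d assume cd: "coprime (nat_of c) (nat_of d)"
    obtain g m' c1 where dec: "m = g * m'" "c = g * c1" "coprime (nat_of m') (nat_of c1)"
      by (rule pnat_gcd_decomp)
    \<comment> \<open>Likewise, \<open>mustar_op m\<close> leaves the numerator \<open>c1\<close>,
      and the gcd of \<open>n * m\<close> and \<open>c\<close> is \<open>h * g\<close>.\<close>
    obtain h n' c' where dec': "n = h * n'" "c1 = h * c'" "coprime (nat_of n') (nat_of c')"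
      by (rule pnat_gcd_decomp)
    have "mustar_op n (mustar_op m (xi y (ratio c d))) =
        frag_cmul (int (nat_of g) * int (nat_of h))
          (xi (sigma (nat_of n') (sigma (nat_of m') y)) (ratio c' (n' * (m' * d))))"
      using cd dec dec' mustar_op_xi[of g c1 d m'] mustar_op_xi[of h c' "m' * d" n']
      by (simp add: ops_frag_cmul coprime_commute)
    moreover have "mustar_op (n * m) (xi y (ratio c d)) = frag_cmul (int (nat_of (h * g)))
          (xi (sigma (nat_of (n' * m')) y) (ratio c' (n' * m' * d)))"
      using cd dec dec' mustar_op_xi[of "h * g" c' d "n' * m'" y]
      by (simp add: ac_simps)
    ultimately show "term_op (MuStar (n * m)) (xi y (ratio c d)) =
        term_op (Mul (MuStar n) (MuStar m)) (xi y (ratio c d))"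
      by (simp add: sigma_sigma ac_simps)
  qed
next
  case (mustar_mu n)
  show ?case
  proof (rule term_op_eqI)
    fix y c d assume cd: "coprime (nat_of c) (nat_of d)"
    obtain m n' d' where dec: "n = m * n'" "d = m * d'" "coprime (nat_of n') (nat_of d')"
      by (rule pnat_gcd_decomp)
    \<comment> \<open>After \<open>mu_op n\<close> the numerator is \<open>n' * c\<close>. Its gcd
      with \<open>n\<close> is \<open>n'\<close>, because \<open>m\<close> divides \<open>d\<close>
      and so is prime to \<open>c\<close>. The factor \<open>n'\<close> and the \<open>m\<close>
      coming from \<open>sigma\<close> after \<open>rho\<close> multiply to
      \<open>n\<close>.\<close>
    have "mustar_op n (mu_op n (xi y (ratio c d))) =
        frag_cmul (int (nat_of n')) (xi (sigma (nat_of m) (rho (nat_of m) y)) (ratio c (m * d')))"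
      using cd dec mustar_op_xi[of n' c d' m] mu_op_xi[of c m d' n' y]
      by (simp add: mult.commute[of m] coprime_commute)
    also have "\<dots> = xi (of_nat (nat_of n) * y) (ratio c d)"
      by (simp add: sigma_rho_cancel dec mult.assoc flip: xi_of_nat_mult)
        (simp add: ac_simps)
    finally show "term_op (Mul (MuStar n) (Mu n)) (xi y (ratio c d)) =
        term_op (Grp (of_nat (nat_of n))) (xi y (ratio c d))"
      using cd by (simp add: grp_op_xi sigma_of_nat)
  qed
next
  case (mu_mustar n m)
  show ?case
  proof (rule term_op_eqI)
    fix y c d assume cd: "coprime (nat_of c) (nat_of d)"
    obtain g n' d' where dec: "n = g * n'" "d = g * d'" "coprime (nat_of n') (nat_of d')"
      by (rule pnat_gcd_decomp)
    obtain h m' c' where dec': "m = h * m'" "c = h * c'" "coprime (nat_of m') (nat_of c')"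
      by (rule pnat_gcd_decomp)
    \<comment> \<open>Coprimality of \<open>n\<close> and \<open>m\<close> means that neither
      operator changes the gcd seen by the other: it is \<open>g\<close> for \<open>mu_op n\<close>
      and \<open>h\<close> for \<open>mustar_op m\<close> in both orders. It remains to exchange
      \<open>rho\<close> at \<open>g\<close> with \<open>sigma\<close> at \<open>m'\<close>.\<close>
    have cop: "coprime (nat_of m') (nat_of n')" "coprime (nat_of m') (nat_of g)"
      "coprime (nat_of h) (nat_of n')"
      using mu_mustar dec dec' by (auto simp: coprime_commute)
    have "mu_op n (mustar_op m (xi y (ratio c d))) = frag_cmul (int (nat_of h))
        (xi (rho (nat_of g) (sigma (nat_of m') y)) (ratio (n' * c') (m' * d')))"
      using cd dec dec' cop mustar_op_xi[of h c' d m' y] mu_op_xi[of c' g "m' * d'" n']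
      by (simp add: ops_frag_cmul coprime_commute mult.left_commute[of _ g])
    moreover have "mustar_op m (mu_op n (xi y (ratio c d))) = frag_cmul (int (nat_of h))
        (xi (sigma (nat_of m') (rho (nat_of g) y)) (ratio (n' * c') (m' * d')))"
      using cd dec dec' cop mu_op_xi[of c g d' n' y] mustar_op_xi[of h "n' * c'" d' m']
      by (simp add: coprime_commute mult.left_commute[of _ h])
    ultimately show "term_op (Mul (Mu n) (MuStar m)) (xi y (ratio c d)) =
        term_op (Mul (MuStar m) (Mu n)) (xi y (ratio c d))"
      using cop by (simp add: sigma_rho_coprime)
  qed
next
  case mu_one
  show ?case
    by (rule term_op_eqI) (simp add: mu_op_xi_gcd)
next
  case mustar_one
  show ?case
    by (rule term_op_eqI) (simp add: mustar_op_xi_gcd)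
qed (auto simp: algebra_simps)

lift_definition bc_rep :: "bc_ring \<Rightarrow> bc_module \<Rightarrow> bc_module" is term_op
  by (rule term_op_cong)

lemma ring_representation_bc_rep: "ring_representation bc_rep"
proof -
  have "additive (bc_rep a)" for a
    by transfer (rule additive_term_op)
  moreover have "bc_rep (a + b) v = bc_rep a v + bc_rep b v"
    "bc_rep (a * b) v = bc_rep a (bc_rep b v)" "bc_rep 1 v = v" for a b v
    by (transfer, simp)+
  ultimately show ?thesis
    by (simp add: ring_representation_def)
qed

lemma bc_rep_grp: "bc_rep (grp x) = grp_op x"
  and bc_rep_mu: "bc_rep (mu a) = mu_op a"
  and bc_rep_mustar: "bc_rep (mustar b) = mustar_op b"
  by (transfer, simp)+

section \<open>Generation of the ring and uniqueness of representations\<close>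

lemma bc_ring_induct [case_names zero one uminus add mult grp mu mustar]:
  assumes "P 0" "P 1" "\<And>a. P a \<Longrightarrow> P (- a)" "\<And>a b. P a \<Longrightarrow> P b \<Longrightarrow> P (a + b)"
    "\<And>a b. P a \<Longrightarrow> P b \<Longrightarrow> P (a * b)"
    "\<And>x. P (grp x)" "\<And>n. P (mu n)" "\<And>n. P (mustar n)"
  shows "P a"
proof -
  \<comment> \<open>Every ring element is the class of a formal expression, so structural induction
    on expressions suffices.\<close>
  have "P (abs_bc_ring t)" for t
    by (induction t)
       (use assms in \<open>simp_all add: zero_bc_ring_def one_bc_ring_def grp_def mu_def mustar_def
         flip: uminus_bc_ring.abs_eq plus_bc_ring.abs_eq times_bc_ring.abs_eq\<close>)
  then show ?thesis
    by (metis Quotient3_abs_rep Quotient3_bc_ring)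
qed

lemma ring_representation_unique:
  assumes rep: "ring_representation \<pi>" "ring_representation \<pi>'"
    and gens: "\<And>x. \<pi> (grp x) = \<pi>' (grp x)" "\<And>n. \<pi> (mu n) = \<pi>' (mu n)"
      "\<And>n. \<pi> (mustar n) = \<pi>' (mustar n)"
  shows "\<pi> = \<pi>'"
proof
  fix a
  have add: "additive (\<lambda>a. \<pi> a v)" "additive (\<lambda>a. \<pi>' a v)" for v
    using rep by (simp_all add: ring_representation_def additive_def)
  show "\<pi> a = \<pi>' a"
  proof (induction a rule: bc_ring_induct)
    case zero
    show ?case using add[THEN additive.zero] by (intro ext) simp
  next
    case one
    show ?case using rep by (intro ext) (simp add: ring_representation_def)
  next
    case (uminus a)
    then show ?case using add[THEN additive.minus] by (intro ext) simp
  next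
    case (add a b)
    then show ?case using rep by (intro ext) (simp add: ring_representation_def)
  next
    case (mult a b)
    then show ?case using rep by (intro ext) (simp add: ring_representation_def)
  qed (fact gens)+
qed


section \<open>Faithfulness\<close>

lemma bc_grp_1: "grp 1 = 1"
  and bc_grp_add: "grp (x + y) = grp x + grp y"
  and bc_grp_mult: "grp (x * y) = grp x * grp y"
  and bc_mu_grp_mustar: "mu n * grp x * mustar n = grp (rho (nat_of n) x)"
  and bc_mustar_grp: "mustar n * grp x = grp (sigma (nat_of n) x) * mustar n"
  and bc_grp_mu: "grp x * mu n = mu n * grp (sigma (nat_of n) x)"
  and bc_mu_mult: "mu (n * m) = mu n * mu m"
  and bc_mustar_mult: "mustar (n * m) = mustar n * mustar m"
  and bc_mustar_mu: "mustar n * mu n = grp (of_nat (nat_of n))"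
  and bc_mu_mustar: "coprime (nat_of n) (nat_of m) \<Longrightarrow> mu n * mustar m = mustar m * mu n"
  and bc_mu_1: "mu 1 = 1"
  and bc_mustar_1: "mustar 1 = 1"
  by (simp_all add: grp_def mu_def mustar_def one_bc_ring_def plus_bc_ring.abs_eq
    times_bc_ring.abs_eq bc_ring.abs_eq_iff grp_one grp_add grp_mult mu_grp_mustar mustar_grp
    grp_mu mu_mult mustar_mult mustar_mu mu_mustar mu_one mustar_one)

lemma additive_grp: "additive grp"
  by (simp add: additive_def bc_grp_add)

section \<open>The additive map from the module back to the ring\<close>

definition word_of :: "qmodz \<times> posrat \<Rightarrow> bc_ring" where
  "word_of = (\<lambda>(s, r). case num_den r of (c, d) \<Rightarrow> mu c * grp (frag_of s) * mustar d)"

text \<open>The values lie in the ring rather than in a free abelian group, so the additive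
  extension of \<open>word_of\<close> is written as a sum over the support.\<close>

definition to_ring :: "bc_module \<Rightarrow> bc_ring" where
  "to_ring v = (\<Sum>p\<in>Poly_Mapping.keys v. of_int (Poly_Mapping.lookup v p) * word_of p)"

text \<open>For additivity: the supports of \<open>v\<close>, \<open>w\<close> and
  \<open>v + w\<close> differ, but all three sums can be taken over one index set.\<close>

lemma to_ring_superset:
  assumes "finite A" "Poly_Mapping.keys v \<subseteq> A"
  shows "to_ring v = (\<Sum>p\<in>A. of_int (Poly_Mapping.lookup v p) * word_of p)"
  unfolding to_ring_def
  by (rule sum.mono_neutral_left) (use assms in \<open>auto simp: in_keys_iff\<close>)

lemma additive_to_ring: "additive to_ring"
proof
  fix v w :: bc_module
  let ?A = "Poly_Mapping.keys v \<union> Poly_Mapping.keys w"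
  have "Poly_Mapping.keys (v + w) \<subseteq> ?A"
    by (rule Poly_Mapping.keys_add)
  then show "to_ring (v + w) = to_ring v + to_ring w"
    by (simp add: to_ring_superset[of ?A] lookup_add ring_distribs sum.distrib)
qed

lemma to_ring_xi:
  assumes "coprime (nat_of c) (nat_of d)"
  shows "to_ring (xi y (ratio c d)) = mu c * grp y * mustar d"
proof (induction y rule: frag_ring_induct)
  case zero
  show ?case
    by (simp add: additive.zero[OF additive_to_ring] additive.zero[OF additive_grp])
next
  case (basis s)
  show ?case
    using assms by (simp add: to_ring_def word_of_def)
next
  case (diff x y)
  then show ?case
    by (simp add: xi_diff additive.diff[OF additive_to_ring] additive.diff[OF additive_grp]
      ring_distribs)
qed

text \<open>The integer appears as \<open>grp (of_nat n)\<close> to match the relation for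
  \<open>mustar n * mu n\<close>.\<close>

lemma to_ring_frag_cmul: "to_ring (frag_cmul (int n) v) = grp (of_nat n) * to_ring v"
  by (induction n)
     (simp_all add: frag_cmul_distrib ring_distribs additive.zero[OF additive_to_ring]
       additive.zero[OF additive_grp] additive.add[OF additive_to_ring] bc_grp_1 bc_grp_add)

text \<open>Since \<open>mu\<close> and \<open>mustar\<close> are multiplicative on a commutative
  monoid, the common factor \<open>m\<close> of \<open>a\<close> and \<open>d\<close> can be moved
  next to \<open>grp y\<close> on both sides, where \<open>mu m * grp y * mustar m\<close> becomes
  \<open>rho\<close>.\<close>

lemma to_ring_mu:
  assumes "coprime (nat_of c) (nat_of d)"
  shows "to_ring (mu_op a (xi y (ratio c d))) = mu a * to_ring (xi y (ratio c d))"
proof -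
  obtain m a' d' where dec: "a = m * a'" "d = m * d'" "coprime (nat_of a') (nat_of d')"
    by (rule pnat_gcd_decomp)
  have cop: "coprime (nat_of (a' * c)) (nat_of d')"
    using assms dec by simp
  have "mu a * to_ring (xi y (ratio c d)) = mu (a' * c * m) * grp y * mustar (m * d')"
  proof -
    have "a * c = a' * c * m"
      by (simp add: dec ac_simps)
    then have "mu a * mu c = mu (a' * c * m)"
      by (metis bc_mu_mult)
    then show ?thesis
      unfolding to_ring_xi[OF assms] by (simp add: dec(2) flip: mult.assoc)
  qed
  also have "\<dots> = mu (a' * c) * (mu m * grp y * mustar m) * mustar d'"
    by (simp only: bc_mu_mult bc_mustar_mult mult.assoc)
  also have "\<dots> = to_ring (mu_op a (xi y (ratio c d)))"
    using assms dec by (simp add: bc_mu_grp_mustar mu_op_xi to_ring_xi[OF cop])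
  finally show ?thesis ..
qed

text \<open>The common factor \<open>k\<close> of \<open>b\<close> and \<open>c\<close> gives
  \<open>mustar k * mu k\<close>, an integer, which moves to the front because \<open>sigma\<close>
  fixes integers. The rest \<open>mustar b'\<close> passes \<open>mu c'\<close> by coprimality,
  turns \<open>y\<close> into its image under \<open>sigma\<close>, and joins
  \<open>mustar d\<close>.\<close>

lemma to_ring_mustar:
  assumes "coprime (nat_of c) (nat_of d)"
  shows "to_ring (mustar_op b (xi y (ratio c d))) = mustar b * to_ring (xi y (ratio c d))"
proof -
  obtain k b' c' where dec: "b = k * b'" "c = k * c'" "coprime (nat_of b') (nat_of c')"
    by (rule pnat_gcd_decomp)
  have cop: "coprime (nat_of c') (nat_of (b' * d))"
    using assms dec by (simp add: coprime_commute)
  have "mustar b = mustar b' * mustar k"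
    by (simp add: dec mult.commute[of k] bc_mustar_mult)
  then have "mustar b * to_ring (xi y (ratio c d)) =
      mustar b' * (mustar k * mu k) * mu c' * grp y * mustar d"
    unfolding to_ring_xi[OF assms] by (simp only: dec(2) bc_mu_mult mult.assoc)
  also have "\<dots> = grp (of_nat (nat_of k)) * (mustar b' * mu c') * grp y * mustar d"
    by (simp only: bc_mustar_grp bc_mustar_mu sigma_of_nat mult.assoc[symmetric])
  also have "\<dots> = grp (of_nat (nat_of k)) * mu c' * (mustar b' * grp y) * mustar d"
  proof -
    have "mustar b' * mu c' = mu c' * mustar b'"
      using bc_mu_mustar[of c' b'] dec(3) by (simp add: coprime_commute)
    then have "mustar b' * (mu c' * z) = mu c' * (mustar b' * z)" for z
      by (simp flip: mult.assoc)
    then show ?thesis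
      by (simp add: mult.assoc)
  qed
  also have "\<dots> = grp (of_nat (nat_of k)) *
      (mu c' * grp (sigma (nat_of b') y) * mustar (b' * d))"
    by (simp only: bc_mustar_grp bc_mustar_mult mult.assoc)
  also have "\<dots> = to_ring (mustar_op b (xi y (ratio c d)))"
    using assms dec by (simp add: mustar_op_xi to_ring_frag_cmul to_ring_xi[OF cop])
  finally show ?thesis ..
qed

lemma to_ring_grp:
  assumes "coprime (nat_of c) (nat_of d)"
  shows "to_ring (grp_op x (xi y (ratio c d))) = grp x * to_ring (xi y (ratio c d))"
proof -
  have "grp x * to_ring (xi y (ratio c d)) = mu c * (grp (sigma (nat_of c) x) * grp y) * mustar d"
    using bc_grp_mu[of x c] unfolding to_ring_xi[OF assms]
    by (simp flip: mult.assoc)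
  then show ?thesis
    using assms by (simp add: grp_op_xi to_ring_xi bc_grp_mult)
qed

text \<open>Generators are settled on reduced fractions by the three preceding lemmas. The vector
  stays arbitrary because in a product the hypothesis for the left factor is applied to the image of
  \<open>v\<close> under the right one.\<close>

lemma to_ring_bc_rep: "to_ring (bc_rep a v) = a * to_ring v"
proof (induction a arbitrary: v rule: bc_ring_induct)
  case (grp x)
  show ?case unfolding bc_rep_grp
    by (rule module_hom_eqI[THEN fun_cong])
       (simp_all add: additive_def additive_ops[THEN additive.add]
         additive_to_ring[THEN additive.add] ring_distribs to_ring_grp)
next
  case (mu n)
  show ?case unfolding bc_rep_mu
    by (rule module_hom_eqI[THEN fun_cong])
       (simp_all add: additive_def additive_ops[THEN additive.add]
         additive_to_ring[THEN additive.add] ring_distribs to_ring_mu)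
next
  case (mustar n)
  show ?case unfolding bc_rep_mustar
    by (rule module_hom_eqI[THEN fun_cong])
       (simp_all add: additive_def additive_ops[THEN additive.add]
         additive_to_ring[THEN additive.add] ring_distribs to_ring_mustar)
next
  case zero
  have "bc_rep 0 v = 0" by transfer simp
  then show ?case by (simp add: additive.zero[OF additive_to_ring])
next
  case (uminus a)
  have "bc_rep (- a) v = - bc_rep a v" by transfer simp
  then show ?case using uminus by (simp add: additive.minus[OF additive_to_ring])
qed (use ring_representation_bc_rep in
  \<open>simp_all add: ring_representation_def additive.add[OF additive_to_ring] ring_distribs mult.assoc\<close>)

lemma inj_bc_rep: "inj bc_rep"
proof (rule injI)
  let ?v = "xi 1 (ratio 1 1)"
  have "to_ring ?v = 1"
    using to_ring_xi[of 1 1 1] by (simp add: bc_grp_1 bc_mu_1 bc_mustar_1)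
  then have "to_ring (bc_rep a ?v) = a" for a
    by (simp add: to_ring_bc_rep)
  then show "a = b" if "bc_rep a = bc_rep b" for a b
    using that by metis
qed

text \<open>The equivalence expresses that the formulas define the representation: from right to
  left they hold for it, from left to right they determine it.\<close>

theorem proposition4p10:
  shows "\<exists>\<pi> :: bc_ring \<Rightarrow> bc_module \<Rightarrow> bc_module.
    faithful_representation \<pi> \<and>
    (\<forall>\<pi>'. (ring_representation \<pi>' \<and>
        (\<forall>x y c d. coprime (nat_of c) (nat_of d) \<longrightarrow>
           \<pi>' (grp x) (xi y (ratio c d)) = xi (sigma (nat_of c) x * y) (ratio c d)) \<and>
        (\<forall>a y c d. coprime (nat_of c) (nat_of d) \<longrightarrow>
           (let m = gcd (nat_of a) (nat_of d)
            in \<pi>' (mu a) (xi y (ratio c d)) = xi (rho m y) (ratio (a * c) d))) \<and>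
        (\<forall>b y c d. coprime (nat_of c) (nat_of d) \<longrightarrow>
           (let n = gcd (nat_of b) (nat_of c)
            in \<pi>' (mustar b) (xi y (ratio c d)) =
                 frag_cmul (int n) (xi (sigma (nat_of b div n) y) (ratio c (b * d)))))) \<longleftrightarrow>
      \<pi>' = \<pi>)"
    (is "\<exists>\<pi>. _ \<and> (\<forall>\<pi>'. ?Q \<pi>' \<longleftrightarrow> _)")
proof (rule exI[of _ bc_rep], intro conjI allI)
  show "faithful_representation bc_rep"
    by (simp add: faithful_representation_def ring_representation_bc_rep inj_bc_rep)
next
  fix \<pi>'
  show "?Q \<pi>' \<longleftrightarrow> \<pi>' = bc_rep"
  proof
    assume Q: "?Q \<pi>'"
    then have add: "additive (\<pi>' a)" for a
      by (simp add: ring_representation_def)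
    show "\<pi>' = bc_rep"
    \<comment> \<open>The formulas fix the action of each generator on reduced fractions. Additivity
      extends this to the whole module, and generation to the whole ring.\<close>
    proof (rule ring_representation_unique)
      show "\<pi>' (grp x) = bc_rep (grp x)" for x
        unfolding bc_rep_grp
        by (rule module_hom_eqI[OF add additive_ops(1)]) (use Q in \<open>simp add: grp_op_xi\<close>)
      show "\<pi>' (mu a) = bc_rep (mu a)" for a
        unfolding bc_rep_mu
        by (rule module_hom_eqI[OF add additive_ops(2)]) (use Q in \<open>simp add: mu_op_xi_gcd Let_def\<close>)
      show "\<pi>' (mustar b) = bc_rep (mustar b)" for b
        unfolding bc_rep_mustar
        by (rule module_hom_eqI[OF add additive_ops(3)])
           (use Q in \<open>simp add: mustar_op_xi_gcd Let_def\<close>)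
    qed (use Q ring_representation_bc_rep in blast)+
  next
    assume "\<pi>' = bc_rep"
    then show "?Q \<pi>'"
      by (simp add: ring_representation_bc_rep bc_rep_grp bc_rep_mu bc_rep_mustar Let_def
        grp_op_xi mu_op_xi_gcd mustar_op_xi_gcd)
  qed
qed

end
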